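(* Let $X$ be a quasi-Banach function lattice over a metric measure space $(\mathcal P,d,\mu)$. Then the Newtonian space $\widetilde N^1X = N^1X/\!\sim$ (where $u\sim v$ if and only if $\|u-v\|_{N^1X}=0$) is complete, i.e., every Cauchy sequence with respect to $\|\cdot\|_{N^1X}$ converges in $\widetilde N^1X$.
   Context: Standing setting: $(\mathcal P,d)$ is a metric space with a $\sigma$-finite Borel regular measure $\mu$ (Borel sets are $\mu$-measurable, and each $\mu$-measurable set $A$ is contained in a Borel set $D$ with $\mu(D)=\mu(A)$), such that every ball has finite positive measure. $\mathcal M(\mathcal P,\mu)$ is the set of extended real-valued $\mu$-measurable functions on $\mathcal P$ (defined everywhere). A quasi-Banach function lattice $X$ is given by a functional $\|\cdot\|_X:\mathcal M(\mathcal P,\mu)\to[0,\infty]$ with $X=\{u\in\mathcal M(\mathcal P,\mu):\|u\|_X<\infty\}$ such that, for some constant $c\ge1$ (the modulus of concavity): (i) $\|u\|_X=0$ iff $u=0$ a.e.; $\|au\|_X=|a|\,\|u\|_X$ for $a\in\mathbb R$; $\|u+v\|_X\le c(\|u\|_X+\|v\|_X)$; (ii) $|u|\le|v|$ a.e. implies $\|u\|_X\le\|v\|_X$; (iii) (Riesz–Fischer) if $u_n\ge0$ a.e. for all $n\ge 1$, then $\bigl\|\sum_{n=1}^\infty u_n\bigr\|_X\le\sum_{n=1}^\infty c^n\|u_n\|_X$. Moreover, $\|\cdot\|_X$ is assumed continuous: $\|u_n-u\|_X\to0$ implies $\|u_n\|_X\to\|u\|_X$. Elements of $X$ are functions defined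 everywhere, not a.e. equivalence classes. A curve is a non-constant rectifiable continuous map from a compact interval to $\mathcal P$, always parametrized by arc length, $\gamma:[0,l_\gamma]\to\mathcal P$. A Borel function $g:\mathcal P\to[0,\infty]$ is an upper gradient of $u:\mathcal P\to\overline{\mathbb R}=\mathbb{R}\cup\{\pm\infty\}$ if $|u(\gamma(0))-u(\gamma(l_\gamma))|\le\int_\gamma g\,ds$ for all curves $\gamma$, with the convention $|(\pm\infty)-(\pm\infty)|=\infty$ in this inequality. For $u\in\mathcal M(\mathcal P,\mu)$, $\|u\|_{N^1X}=\|u\|_X+\inf_g\|g\|_X$, the infimum being over all upper gradients $g$ of $u$; $N^1X=\{u\in\mathcal M(\mathcal P,\mu):\|u\|_{N^1X}<\infty\}$ (functions defined everywhere). When forming linear combinations of functions pointwise, the value at points where the expression is of the form $\infty-\infty$ is taken to be $0$. *)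

theory Defs
  imports "HOL-Analysis.Analysis"
begin

text \<open>
  Pointwise sums and differences of extended real-valued functions, where expressions of the form
  \<open>\<infinity> - \<infinity>\<close> have the value 0.  The library operations cannot be used for this purpose, since there
  \<open>\<infinity> + (-\<infinity>) = \<infinity>\<close> for \<^typ>\<open>ereal\<close>.
\<close>

definition fun_add :: "('a \<Rightarrow> ereal) \<Rightarrow> ('a \<Rightarrow> ereal) \<Rightarrow> 'a \<Rightarrow> ereal" where
  "fun_add u v = (\<lambda>x. if \<bar>u x\<bar> = \<infinity> \<and> v x = - u x then 0 else u x + v x)"

definition fun_diff :: "('a \<Rightarrow> ereal) \<Rightarrow> ('a \<Rightarrow> ereal) \<Rightarrow> 'a \<Rightarrow> ereal" where
  "fun_diff u v = fun_add u (\<lambda>x. - v x)"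

locale borel_regular_metric_measure = sigma_finite_measure M
  for M :: "'a::metric_space measure" +
  assumes space_eq_UNIV: "space M = UNIV"
    and borel_sets: "sets borel \<subseteq> sets M"
    and borel_hull: "A \<in> sets M \<Longrightarrow> \<exists>D\<in>sets borel. A \<subseteq> D \<and> emeasure M D = emeasure M A"
    and ball_pos: "r > 0 \<Longrightarrow> emeasure M (ball x r) > 0"
    and ball_finite: "r > 0 \<Longrightarrow> emeasure M (ball x r) < \<infinity>"

text \<open>
  The functional \<open>nX\<close> is constrained on measurable functions only.  In \<open>riesz_fischer\<close> the sequence
  is indexed from 0, whence the exponent \<^term>\<open>Suc n\<close>; as its terms are nonnegative only almost
  everywhere, the sum is represented by any measurable function \<open>s\<close> that agrees with it almost
  everywhere.
\<close>

locale quasi_banach_function_lattice = borel_regular_metric_measure M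
  for M :: "'a::metric_space measure" +
  fixes nX :: "('a \<Rightarrow> ereal) \<Rightarrow> ennreal" and c :: real
  assumes c_ge_1: "c \<ge> 1"
    and norm_eq_0_iff: "u \<in> borel_measurable M \<Longrightarrow> nX u = 0 \<longleftrightarrow> (AE x in M. u x = 0)"
    and norm_scale: "u \<in> borel_measurable M \<Longrightarrow> nX (\<lambda>x. ereal a * u x) = ennreal \<bar>a\<bar> * nX u"
    and norm_add: "u \<in> borel_measurable M \<Longrightarrow> v \<in> borel_measurable M \<Longrightarrow>
      nX (fun_add u v) \<le> ennreal c * (nX u + nX v)"
    and norm_mono: "u \<in> borel_measurable M \<Longrightarrow> v \<in> borel_measurable M \<Longrightarrow>
      (AE x in M. \<bar>u x\<bar> \<le> \<bar>v x\<bar>) \<Longrightarrow> nX u \<le> nX v"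
    and riesz_fischer: "(\<And>n. f n \<in> borel_measurable M) \<Longrightarrow> (\<And>n. AE x in M. f n x \<ge> 0) \<Longrightarrow>
      s \<in> borel_measurable M \<Longrightarrow> (AE x in M. s x = (\<Sum>n. f n x)) \<Longrightarrow>
      nX s \<le> (\<Sum>n. ennreal c ^ Suc n * nX (f n))"
    and norm_continuous: "(\<And>n. f n \<in> borel_measurable M) \<Longrightarrow> u \<in> borel_measurable M \<Longrightarrow>
      (\<lambda>n. nX (fun_diff (f n) u)) \<longlonglongrightarrow> 0 \<Longrightarrow> (\<lambda>n. nX (f n)) \<longlonglongrightarrow> nX u"

definition curve_length :: "(real \<Rightarrow> 'a::metric_space) \<Rightarrow> real \<Rightarrow> real \<Rightarrow> ennreal" where
  "curve_length \<gamma> a b =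
    (SUP (n :: nat, t :: nat \<Rightarrow> real) \<in> {(n, t). mono t \<and> range t \<subseteq> {a..b}}.
      \<Sum>i<n. ennreal (dist (\<gamma> (t i)) (\<gamma> (t (Suc i)))))"

text \<open>
  A non-constant rectifiable curve of length \<open>l\<close>, parametrized by arc length on \<open>[0, l]\<close>; the last
  condition includes that the total length is \<open>l\<close>, hence finite.
\<close>

definition arclength_curve :: "(real \<Rightarrow> 'a::metric_space) \<Rightarrow> real \<Rightarrow> bool" where
  "arclength_curve \<gamma> l \<longleftrightarrow> l \<ge> 0 \<and> continuous_on {0..l} \<gamma> \<and> \<not> \<gamma> constant_on {0..l} \<and>
    (\<forall>t\<in>{0..l}. curve_length \<gamma> 0 t = ennreal t)"

text \<open>
  In \<^typ>\<open>ereal\<close>, a difference of two infinite values is again infinite, whatever their signs, so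
  the library subtraction gives \<open>\<bar>(\<plusminus>\<infinity>) - (\<plusminus>\<infinity>)\<bar> = \<infinity>\<close> as required here.
\<close>

definition upper_gradient :: "('a::metric_space \<Rightarrow> ennreal) \<Rightarrow> ('a \<Rightarrow> ereal) \<Rightarrow> bool" where
  "upper_gradient g u \<longleftrightarrow> g \<in> borel_measurable borel \<and>
    (\<forall>\<gamma> l. arclength_curve \<gamma> l \<longrightarrow>
      e2ennreal \<bar>u (\<gamma> 0) - u (\<gamma> l)\<bar> \<le> (\<integral>\<^sup>+t\<in>{0..l}. g (\<gamma> t) \<partial>lborel))"

definition newton_norm ::
  "(('a::metric_space \<Rightarrow> ereal) \<Rightarrow> ennreal) \<Rightarrow> ('a \<Rightarrow> ereal) \<Rightarrow> ennreal" where
  "newton_norm nX u = nX u + (INF g\<in>{g. upper_gradient g u}. nX (\<lambda>x. enn2ereal (g x)))"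

definition newton_space ::
  "'a::metric_space measure \<Rightarrow> (('a \<Rightarrow> ereal) \<Rightarrow> ennreal) \<Rightarrow> ('a \<Rightarrow> ereal) set" where
  "newton_space M nX = {u \<in> borel_measurable M. newton_norm nX u < \<infinity>}"

definition newton_rel ::
  "'a::metric_space measure \<Rightarrow> (('a \<Rightarrow> ereal) \<Rightarrow> ennreal) \<Rightarrow> (('a \<Rightarrow> ereal) \<times> ('a \<Rightarrow> ereal)) set" where
  "newton_rel M nX = {(u, v). u \<in> newton_space M nX \<and> v \<in> newton_space M nX \<and>
    newton_norm nX (fun_diff u v) = 0}"

definition newton_quotient ::
  "'a::metric_space measure \<Rightarrow> (('a \<Rightarrow> ereal) \<Rightarrow> ennreal) \<Rightarrow> ('a \<Rightarrow> ereal) set set" where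
  "newton_quotient M nX = newton_space M nX // newton_rel M nX"

text \<open>
  The quasinorm of the difference of two classes.  The infimum is over a constant family: by
  \<open>newton_class_dist_eq\<close> below, any choice of representatives yields the same value.
\<close>

definition newton_class_dist ::
  "(('a::metric_space \<Rightarrow> ereal) \<Rightarrow> ennreal) \<Rightarrow> ('a \<Rightarrow> ereal) set \<Rightarrow> ('a \<Rightarrow> ereal) set \<Rightarrow> ennreal" where
  "newton_class_dist nX A B = (INF (u, v)\<in>A \<times> B. newton_norm nX (fun_diff u v))"


lemma fun_diff_commute: "fun_diff v u x = - fun_diff u v x"
  by (cases "u x"; cases "v x") (auto simp: fun_diff_def fun_add_def)

lemma fun_diff_eq_0_iff: "fun_diff u v x = 0 \<longleftrightarrow> u x = v x"
  by (cases "u x"; cases "v x") (auto simp: fun_diff_def fun_add_def)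

lemma fun_diff_finite_split:
  assumes "\<bar>fun_diff u v x\<bar> \<noteq> \<infinity>" "\<bar>fun_diff v w x\<bar> \<noteq> \<infinity>"
  shows "fun_diff u w x = fun_diff u v x + fun_diff v w x"
  using assms
  by (cases "u x"; cases "v x"; cases "w x") (auto simp: fun_diff_def fun_add_def)

lemma ereal_abs_diff_infinite: "\<bar>a\<bar> = \<infinity> \<or> \<bar>b\<bar> = \<infinity> \<Longrightarrow> \<bar>a - b\<bar> = (\<infinity>::ereal)"
  by (cases a; cases b) auto

lemma fun_diff_triangle:
  "\<bar>fun_diff u w p - fun_diff u w q\<bar> \<le>
    \<bar>fun_diff u v p - fun_diff u v q\<bar> + \<bar>fun_diff v w p - fun_diff v w q\<bar>"
proof (cases "\<bar>fun_diff u v p\<bar> = \<infinity> \<or> \<bar>fun_diff u v q\<bar> = \<infinity> \<or>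
    \<bar>fun_diff v w p\<bar> = \<infinity> \<or> \<bar>fun_diff v w q\<bar> = \<infinity>")
  case True
  then have "\<bar>fun_diff u v p - fun_diff u v q\<bar> + \<bar>fun_diff v w p - fun_diff v w q\<bar> = \<infinity>"
    using ereal_abs_diff_infinite by (metis ereal_plus_eq_PInfty)
  then show ?thesis by (simp only: ereal_less_eq)
next
  case False
  then have "fun_diff u w p = fun_diff u v p + fun_diff v w p"
    "fun_diff u w q = fun_diff u v q + fun_diff v w q"
    by (auto intro: fun_diff_finite_split)
  moreover obtain a b c d where "fun_diff u v p = ereal a" "fun_diff u v q = ereal b"
    "fun_diff v w p = ereal c" "fun_diff v w q = ereal d"
    using False by (metis ereal_real')
  ultimately show ?thesis by simp
qed

lemma e2ennreal_plus: "0 \<le> a \<Longrightarrow> 0 \<le> b \<Longrightarrow> e2ennreal (a + b) = e2ennreal a + e2ennreal b"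
  by (simp add: plus_ennreal.abs_eq eq_onp_def)

lemma fun_diff_measurable [measurable]:
  assumes [measurable]: "u \<in> borel_measurable M" "v \<in> borel_measurable M"
  shows "fun_diff u v \<in> borel_measurable M"
  unfolding fun_diff_def fun_add_def by measurable

lemma upper_gradient_cong:
  assumes "\<And>p q. \<bar>u p - u q\<bar> = \<bar>v p - v q\<bar>"
  shows "upper_gradient g u \<longleftrightarrow> upper_gradient g v"
  using assms by (simp add: upper_gradient_def)

lemma upper_gradient_zero: "upper_gradient (\<lambda>_. 0) (\<lambda>_. 0)"
  by (simp add: upper_gradient_def zero_ereal_def flip: zero_ennreal.abs_eq)

lemma upper_gradient_diff_add:
  assumes g: "upper_gradient g (fun_diff u v)" and h: "upper_gradient h (fun_diff v w)"
  shows "upper_gradient (\<lambda>x. g x + h x) (fun_diff u w)"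
  unfolding upper_gradient_def
proof (intro conjI allI impI)
  have [measurable]: "g \<in> borel_measurable borel" "h \<in> borel_measurable borel"
    using g h by (auto simp: upper_gradient_def)
  show "(\<lambda>x. g x + h x) \<in> borel_measurable borel" by measurable
  fix \<gamma> :: "real \<Rightarrow> 'a" and l
  assume \<gamma>: "arclength_curve \<gamma> l"
  have "\<gamma> \<in> borel_measurable (restrict_space borel {0..l})"
    using \<gamma> by (intro borel_measurable_continuous_on_restrict) (auto simp: arclength_curve_def)
  then have meas: "(\<lambda>t. k (\<gamma> t) * indicator {0..l} t) \<in> borel_measurable borel"
    if "k \<in> borel_measurable borel" for k :: "'a \<Rightarrow> ennreal"
  proof -
    have "(\<lambda>t. k (\<gamma> t)) \<in> borel_measurable (restrict_space borel {0..l})"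
      using \<open>\<gamma> \<in> _\<close> that by (rule measurable_compose)
    then show ?thesis
      by (subst (asm) borel_measurable_restrict_space_iff_ennreal) auto
  qed
  have "e2ennreal \<bar>fun_diff u w (\<gamma> 0) - fun_diff u w (\<gamma> l)\<bar> \<le>
      e2ennreal (\<bar>fun_diff u v (\<gamma> 0) - fun_diff u v (\<gamma> l)\<bar> + \<bar>fun_diff v w (\<gamma> 0) - fun_diff v w (\<gamma> l)\<bar>)"
    by (intro e2ennreal_mono fun_diff_triangle)
  also have "\<dots> = e2ennreal \<bar>fun_diff u v (\<gamma> 0) - fun_diff u v (\<gamma> l)\<bar> +
      e2ennreal \<bar>fun_diff v w (\<gamma> 0) - fun_diff v w (\<gamma> l)\<bar>"
    by (intro e2ennreal_plus) auto
  also have "\<dots> \<le> (\<integral>\<^sup>+t\<in>{0..l}. g (\<gamma> t) \<partial>lborel) + (\<integral>\<^sup>+t\<in>{0..l}. h (\<gamma> t) \<partial>lborel)"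
    using g h \<gamma> by (intro add_mono) (auto simp: upper_gradient_def)
  also have "\<dots> = (\<integral>\<^sup>+t\<in>{0..l}. (g (\<gamma> t) + h (\<gamma> t)) \<partial>lborel)"
    by (subst nn_integral_add[symmetric]) (auto simp: meas distrib_right)
  finally show "e2ennreal \<bar>fun_diff u w (\<gamma> 0) - fun_diff u w (\<gamma> l)\<bar> \<le>
    (\<integral>\<^sup>+t\<in>{0..l}. (g (\<gamma> t) + h (\<gamma> t)) \<partial>lborel)" .
qed

context quasi_banach_function_lattice
begin

lemma norm_cong:
  assumes "u \<in> borel_measurable M" "v \<in> borel_measurable M" "AE x in M. \<bar>u x\<bar> = \<bar>v x\<bar>"
  shows "nX u = nX v"
  using assms by (intro antisym norm_mono) (auto elim: AE_mp)

lemma borel_measurable_enn2ereal: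
  assumes g: "g \<in> borel_measurable borel"
  shows "(\<lambda>x. enn2ereal (g x)) \<in> borel_measurable M"
proof -
  have "(\<lambda>x. enn2ereal (g x)) \<in> borel_measurable borel"
    using g by measurable
  then show ?thesis
    using borel_sets space_eq_UNIV by (auto simp: measurable_def)
qed

lemma newton_norm_zero: "newton_norm nX (\<lambda>_. 0) = 0"
proof -
  have "nX (\<lambda>_. 0) = 0" by (subst norm_eq_0_iff) auto
  moreover have "(INF g\<in>{g. upper_gradient g (\<lambda>_::'a. 0)}. nX (\<lambda>x. enn2ereal (g x)))
      \<le> nX (\<lambda>x. enn2ereal 0)"
    using upper_gradient_zero by (intro INF_lower2[of "\<lambda>_. 0"]) auto
  ultimately show ?thesis by (simp add: newton_norm_def zero_ennreal.rep_eq)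
qed

lemma newton_norm_diff_commute:
  assumes [measurable]: "u \<in> borel_measurable M" "v \<in> borel_measurable M"
  shows "newton_norm nX (fun_diff v u) = newton_norm nX (fun_diff u v)"
proof -
  have "nX (fun_diff v u) = nX (fun_diff u v)"
    by (intro norm_cong) (auto simp: fun_diff_commute[of v u])
  moreover have "upper_gradient g (fun_diff v u) \<longleftrightarrow> upper_gradient g (fun_diff u v)" for g
  proof (rule upper_gradient_cong)
    fix p q
    show "\<bar>fun_diff v u p - fun_diff v u q\<bar> = \<bar>fun_diff u v p - fun_diff u v q\<bar>"
      unfolding fun_diff_commute[of v u]
      by (cases "fun_diff u v p"; cases "fun_diff u v q") auto
  qed
  ultimately show ?thesis by (simp add: newton_norm_def)
qed

lemma newton_norm_diff_le:
  assumes [measurable]: "u \<in> borel_measurable M" "v \<in> borel_measurable M" "w \<in> borel_measurable M"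
    and uv: "newton_norm nX (fun_diff u v) = 0"
  shows "newton_norm nX (fun_diff u w) \<le> newton_norm nX (fun_diff v w)"
proof -
  let ?e = "\<lambda>g x. enn2ereal (g x)"
  have "nX (fun_diff u v) = 0" using uv by (simp add: newton_norm_def)
  then have "AE x in M. u x = v x" by (simp add: norm_eq_0_iff fun_diff_eq_0_iff)
  then have "nX (fun_diff u w) = nX (fun_diff v w)"
    by (intro norm_cong) (auto elim!: eventually_mono simp: fun_diff_def fun_add_def)
  moreover have "(INF g\<in>{g. upper_gradient g (fun_diff u w)}. nX (?e g)) \<le> nX (?e h)"
    if h: "upper_gradient h (fun_diff v w)" for h
  proof -
    have "(INF g\<in>{g. upper_gradient g (fun_diff u v)}. nX (?e g)) = 0"
      using uv by (simp add: newton_norm_def)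
    then have "\<exists>g. upper_gradient g (fun_diff u v) \<and> nX (?e g) < ennreal (inverse (Suc n))" for n
      by (metis (no_types, lifting) INF_less_iff ennreal_less_zero_iff inverse_positive_iff_positive
          mem_Collect_eq of_nat_0_less_iff zero_less_Suc)
    then obtain G where G: "\<And>n. upper_gradient (G n) (fun_diff u v)"
      "\<And>n. nX (?e (G n)) < ennreal (inverse (Suc n))" by metis
    let ?s = "\<lambda>n x. G n x + h x"
    have [measurable]: "G n \<in> borel_measurable borel" "h \<in> borel_measurable borel" for n
      using G(1) h by (auto simp: upper_gradient_def)
    have m [measurable]: "?e (G n) \<in> borel_measurable M" "?e h \<in> borel_measurable M"
      "?e (?s n) \<in> borel_measurable M" for n
      using borel_measurable_enn2ereal[of "G n"] borel_measurable_enn2ereal[of h]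
        borel_measurable_enn2ereal[of "?s n"] by measurable
    have le: "nX (fun_diff (?e (?s n)) (?e h)) \<le> nX (?e (G n))" for n
    proof (intro norm_mono AE_I2)
      fix x
      show "\<bar>fun_diff (?e (?s n)) (?e h) x\<bar> \<le> \<bar>?e (G n) x\<bar>"
        by (cases "G n x"; cases "h x")
          (auto simp: fun_diff_def fun_add_def plus_ennreal.rep_eq enn2ereal_ennreal)
    qed measurable
    have lim: "(\<lambda>n. nX (?e (G n))) \<longlonglongrightarrow> 0"
    proof (rule tendsto_sandwich[OF _ _ tendsto_const])
      show "(\<lambda>n. ennreal (inverse (Suc n))) \<longlonglongrightarrow> 0"
        using tendsto_ennrealI[OF LIMSEQ_inverse_real_of_nat] by simp
    qed (use G(2) in \<open>auto intro!: always_eventually less_imp_le simp del: of_nat_Suc\<close>)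
    have "(\<lambda>n. nX (fun_diff (?e (?s n)) (?e h))) \<longlonglongrightarrow> 0"
      by (rule tendsto_sandwich[OF _ _ tendsto_const lim])
        (rule always_eventually, rule allI, rule zero_le, rule always_eventually, rule allI, rule le)
    then have "(\<lambda>n. nX (?e (?s n))) \<longlonglongrightarrow> nX (?e h)"
      by (rule norm_continuous[OF m(3) m(2)])
    moreover have "(INF g\<in>{g. upper_gradient g (fun_diff u w)}. nX (?e g)) \<le> nX (?e (?s n))" for n
      by (rule INF_lower) (rule CollectI, rule upper_gradient_diff_add[OF G(1) h])
    ultimately show ?thesis
      by (rule LIMSEQ_le_const[OF _ exI, OF _ allI, OF _ impI])
  qed
  ultimately show ?thesis
    unfolding newton_norm_def by (intro add_mono INF_greatest) auto
qed

lemma newton_norm_diff_eq: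
  assumes "u \<in> borel_measurable M" "v \<in> borel_measurable M" "w \<in> borel_measurable M"
    and "newton_norm nX (fun_diff u v) = 0"
  shows "newton_norm nX (fun_diff u w) = newton_norm nX (fun_diff v w)"
proof (rule antisym)
  show "newton_norm nX (fun_diff u w) \<le> newton_norm nX (fun_diff v w)"
    using assms by (rule newton_norm_diff_le)
  have "newton_norm nX (fun_diff v u) = 0"
    using newton_norm_diff_commute[OF assms(1,2)] assms(4) by (rule trans)
  then show "newton_norm nX (fun_diff v w) \<le> newton_norm nX (fun_diff u w)"
    by (rule newton_norm_diff_le[OF assms(2,1,3)])
qed

lemma equiv_newton_rel: "equiv (newton_space M nX) (newton_rel M nX)"
proof (rule equivI)
  show "refl_on (newton_space M nX) (newton_rel M nX)"
  proof (rule refl_onI)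
    fix u :: "'a \<Rightarrow> ereal"
    have "fun_diff u u = (\<lambda>_. 0)" by (auto simp: fun_eq_iff fun_diff_eq_0_iff)
    then show "u \<in> newton_space M nX \<Longrightarrow> (u, u) \<in> newton_rel M nX"
      by (simp add: newton_rel_def newton_norm_zero)
  qed
  show "sym (newton_rel M nX)"
    by (rule symI) (simp add: newton_rel_def newton_space_def newton_norm_diff_commute)
  show "trans (newton_rel M nX)"
  proof (rule transI)
    fix u v w
    assume uv: "(u, v) \<in> newton_rel M nX" and vw: "(v, w) \<in> newton_rel M nX"
    have "newton_norm nX (fun_diff u w) = newton_norm nX (fun_diff v w)"
      using uv vw by (intro newton_norm_diff_eq) (simp_all add: newton_rel_def newton_space_def)
    with uv vw show "(u, w) \<in> newton_rel M nX"
      by (simp add: newton_rel_def)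
  qed
qed (auto simp: newton_rel_def)

lemma newton_class_dist_eq:
  assumes "u \<in> newton_space M nX" "v \<in> newton_space M nX"
  shows "newton_class_dist nX (newton_rel M nX `` {u}) (newton_rel M nX `` {v}) =
    newton_norm nX (fun_diff u v)"
proof -
  have "newton_norm nX (fun_diff a b) = newton_norm nX (fun_diff u v)"
    if "(u, a) \<in> newton_rel M nX" "(v, b) \<in> newton_rel M nX" for a b
  proof -
    have [simp]: "u \<in> borel_measurable M" "a \<in> borel_measurable M"
      "v \<in> borel_measurable M" "b \<in> borel_measurable M"
      using that by (simp_all add: newton_rel_def newton_space_def)
    have "newton_norm nX (fun_diff u v) = newton_norm nX (fun_diff a v)"
      using that(1) by (intro newton_norm_diff_eq) (simp_all add: newton_rel_def)
    also have "\<dots> = newton_norm nX (fun_diff v a)"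
      by (rule newton_norm_diff_commute) simp_all
    also have "\<dots> = newton_norm nX (fun_diff b a)"
      using that(2) by (intro newton_norm_diff_eq) (simp_all add: newton_rel_def)
    also have "\<dots> = newton_norm nX (fun_diff a b)"
      by (rule newton_norm_diff_commute) simp_all
    finally show ?thesis ..
  qed
  then have const: "(case p of (a, b) \<Rightarrow> newton_norm nX (fun_diff a b)) = newton_norm nX (fun_diff u v)"
    if "p \<in> newton_rel M nX `` {u} \<times> newton_rel M nX `` {v}" for p
    using that by (cases p) simp
  have "newton_rel M nX `` {u} \<times> newton_rel M nX `` {v} \<noteq> {}"
    using assms[THEN equiv_class_self[OF equiv_newton_rel]] by blast
  then show ?thesis
    unfolding newton_class_dist_def using const by (rule INF_eq_const)
qed

end

end

theory Submission
  imports Defs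
begin

text \<open>
  Pass to representatives \<open>u\<^sub>j\<close> of a subsequence whose increments \<open>u\<^sub>j\<^sub>+\<^sub>1 - u\<^sub>j\<close> have norm less than
  \<open>(2 c)\<^sup>-\<^sup>j\<^sup>-\<^sup>1\<close>, which makes the factors \<open>c\<^sup>n\<close> in the Riesz--Fischer property harmless, and choose
  upper gradients \<open>G\<^sub>j\<close> of the increments (and of \<open>u\<^sub>0\<close>) accordingly.  The telescoping series converges
  absolutely outside a null set; let \<open>D\<close> be a Borel null set containing that set.  The function
  \<open>\<rho> = (\<Sum>j. G\<^sub>j) + \<infinity> \<cdot> 1\<^sub>D\<close> has finite norm, and its integral along every curve with an endpoint at
  which the series diverges is infinite.  Hence for the pointwise limit \<open>u\<close>, set to 0 where the
  series diverges, and for any \<open>\<epsilon> > 0\<close>, the tail of \<open>\<Sum>j. G\<^sub>j\<close> plus \<open>\<epsilon> \<rho>\<close> is an upper gradient of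
  \<open>u - u\<^sub>k\<close>.
\<close>

section \<open>Arc-length curves and the propagation of divergence along them\<close>

lemma arclength_curve_pos:
  assumes "arclength_curve \<gamma> l"
  shows "l > 0"
proof (rule ccontr)
  assume "\<not> l > 0"
  then have "{0..l} \<subseteq> {0}" by auto
  then have "\<gamma> constant_on {0..l}" unfolding constant_on_def by blast
  then show False using assms by (simp add: arclength_curve_def)
qed

text \<open>This lets upper gradients be tested between \<open>\<gamma> 0\<close> and any
  intermediate point. If \<open>\<gamma>\<close> were constant on \<open>{0..b}\<close>, its length
  there would be 0 instead of \<open>b\<close>.\<close>

lemma arclength_curve_initial:
  assumes \<gamma>: "arclength_curve \<gamma> l" and b: "0 < b" "b \<le> l"
  shows "arclength_curve \<gamma> b"
proof -
  have "\<not> \<gamma> constant_on {0..b}"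
  proof
    assume "\<gamma> constant_on {0..b}"
    then obtain y where y: "\<And>t. t \<in> {0..b} \<Longrightarrow> \<gamma> t = y" by (auto simp: constant_on_def)
    have "(\<Sum>i<n. ennreal (dist (\<gamma> (t i)) (\<gamma> (t (Suc i))))) = 0" if "range t \<subseteq> {0..b}" for n t
    proof (intro sum.neutral ballI)
      fix i
      have "t i \<in> {0..b}" "t (Suc i) \<in> {0..b}" using that by blast+
      then show "ennreal (dist (\<gamma> (t i)) (\<gamma> (t (Suc i)))) = 0" using y by simp
    qed
    then have "curve_length \<gamma> 0 b \<le> 0"
      unfolding curve_length_def by (intro SUP_least) auto
    moreover have "curve_length \<gamma> 0 b = ennreal b" using \<gamma> b by (simp add: arclength_curve_def)
    ultimately show False using b by simp
  qed
  moreover have "continuous_on {0..l} \<gamma>" and "\<forall>t\<in>{0..l}. curve_length \<gamma> 0 t = ennreal t"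
    using \<gamma> by (simp_all add: arclength_curve_def)
  then have "continuous_on {0..b} \<gamma>" and "\<forall>t\<in>{0..b}. curve_length \<gamma> 0 t = ennreal t"
    using b by (auto intro: continuous_on_subset)
  ultimately show ?thesis using b by (simp add: arclength_curve_def)
qed

lemma borel_measurable_along_curve:
  fixes k :: "'a::metric_space \<Rightarrow> ennreal"
  assumes \<gamma>: "arclength_curve \<gamma> l" and k: "k \<in> borel_measurable borel"
  shows "(\<lambda>t. k (\<gamma> t) * indicator {0..l} t) \<in> borel_measurable borel"
proof -
  have "\<gamma> \<in> borel_measurable (restrict_space borel {0..l})"
    using \<gamma> by (intro borel_measurable_continuous_on_restrict) (auto simp: arclength_curve_def)
  then have "(\<lambda>t. k (\<gamma> t)) \<in> borel_measurable (restrict_space borel {0..l})"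
    using k by (rule measurable_compose)
  then show ?thesis
    by (subst (asm) borel_measurable_restrict_space_iff_ennreal) auto
qed

lemma nn_integral_along_curve_suminf:
  fixes G :: "nat \<Rightarrow> 'a::metric_space \<Rightarrow> ennreal"
  assumes "arclength_curve \<gamma> l" and "\<And>n. G n \<in> borel_measurable borel"
  shows "(\<integral>\<^sup>+t\<in>{0..l}. (\<Sum>n. G n (\<gamma> t)) \<partial>lborel) = (\<Sum>n. \<integral>\<^sup>+t\<in>{0..l}. G n (\<gamma> t) \<partial>lborel)"
  using borel_measurable_along_curve[OF assms(1) assms(2)]
  by (subst nn_integral_suminf[symmetric]) auto

text \<open>Infinite values do no harm: the library difference has infinite modulus as soon as one
  argument is infinite.\<close>

lemma e2ennreal_abs_le_add_diff: "e2ennreal \<bar>a\<bar> \<le> e2ennreal \<bar>b\<bar> + e2ennreal \<bar>a - b\<bar>"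
proof -
  have "\<bar>a\<bar> \<le> \<bar>b\<bar> + \<bar>a - b\<bar>" by (cases a; cases b) auto
  then have "e2ennreal \<bar>a\<bar> \<le> e2ennreal (\<bar>b\<bar> + \<bar>a - b\<bar>)" by (rule e2ennreal_mono)
  then show ?thesis by (simp add: e2ennreal_plus)
qed

text \<open>The upper gradient inequalities of all terms are added up. No subtraction occurs, so
  both series may diverge; if the integral is finite, divergence at one endpoint forces divergence
  at the other.\<close>

lemma suminf_abs_le_along_curve:
  assumes ug: "\<And>n. upper_gradient (G n) (f n)" and \<gamma>: "arclength_curve \<gamma> l"
  shows "(\<Sum>n. e2ennreal \<bar>f n (\<gamma> 0)\<bar>) \<le>
      (\<Sum>n. e2ennreal \<bar>f n (\<gamma> l)\<bar>) + (\<integral>\<^sup>+t\<in>{0..l}. (\<Sum>n. G n (\<gamma> t)) \<partial>lborel)" (is ?A)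
    and "(\<Sum>n. e2ennreal \<bar>f n (\<gamma> l)\<bar>) \<le>
      (\<Sum>n. e2ennreal \<bar>f n (\<gamma> 0)\<bar>) + (\<integral>\<^sup>+t\<in>{0..l}. (\<Sum>n. G n (\<gamma> t)) \<partial>lborel)" (is ?B)
proof -
  have G: "G n \<in> borel_measurable borel" for n using ug by (simp add: upper_gradient_def)
  have I: "e2ennreal \<bar>f n (\<gamma> 0) - f n (\<gamma> l)\<bar> \<le> (\<integral>\<^sup>+t\<in>{0..l}. G n (\<gamma> t) \<partial>lborel)" for n
    using ug \<gamma> by (simp add: upper_gradient_def)
  have sym: "\<bar>f n (\<gamma> l) - f n (\<gamma> 0)\<bar> = \<bar>f n (\<gamma> 0) - f n (\<gamma> l)\<bar>" for n
    by (cases "f n (\<gamma> 0)"; cases "f n (\<gamma> l)") auto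
  have "e2ennreal \<bar>f n (\<gamma> 0)\<bar> \<le> e2ennreal \<bar>f n (\<gamma> l)\<bar> + (\<integral>\<^sup>+t\<in>{0..l}. G n (\<gamma> t) \<partial>lborel)" for n
    using e2ennreal_abs_le_add_diff[of "f n (\<gamma> 0)" "f n (\<gamma> l)"] I[of n]
    by (meson add_left_mono order_trans)
  then show ?A
    unfolding nn_integral_along_curve_suminf[OF \<gamma> G]
    by (subst suminf_add[OF summableI summableI]) (intro suminf_le summableI)
  have "e2ennreal \<bar>f n (\<gamma> l)\<bar> \<le> e2ennreal \<bar>f n (\<gamma> 0)\<bar> + (\<integral>\<^sup>+t\<in>{0..l}. G n (\<gamma> t) \<partial>lborel)" for n
    using e2ennreal_abs_le_add_diff[of "f n (\<gamma> l)" "f n (\<gamma> 0)"] I[of n]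
    unfolding sym by (meson add_left_mono order_trans)
  then show ?B
    unfolding nn_integral_along_curve_suminf[OF \<gamma> G]
    by (subst suminf_add[OF summableI summableI]) (intro suminf_le summableI)
qed

text \<open>
  If the integral of \<open>\<Sum>n. G n\<close> along the curve is finite, then divergence of the series at one
  endpoint spreads along the whole curve, which therefore runs inside \<open>D\<close>.
\<close>

lemma nn_integral_along_curve_eq_top:
  assumes ug: "\<And>n. upper_gradient (G n) (f n)" and \<gamma>: "arclength_curve \<gamma> l"
    and D: "D \<in> sets borel" "\<And>x. (\<Sum>n. e2ennreal \<bar>f n x\<bar>) = top \<Longrightarrow> x \<in> D"
    and div: "(\<Sum>n. e2ennreal \<bar>f n (\<gamma> 0)\<bar>) = top \<or> (\<Sum>n. e2ennreal \<bar>f n (\<gamma> l)\<bar>) = top"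
  shows "(\<integral>\<^sup>+t\<in>{0..l}. ((\<Sum>n. G n (\<gamma> t)) + top * indicator D (\<gamma> t)) \<partial>lborel) = top"
proof (cases "(\<integral>\<^sup>+t\<in>{0..l}. (\<Sum>n. G n (\<gamma> t)) \<partial>lborel) = top")
  case True
  have "(\<integral>\<^sup>+t\<in>{0..l}. (\<Sum>n. G n (\<gamma> t)) \<partial>lborel) \<le>
      (\<integral>\<^sup>+t\<in>{0..l}. ((\<Sum>n. G n (\<gamma> t)) + top * indicator D (\<gamma> t)) \<partial>lborel)"
    by (intro nn_integral_mono mult_right_mono) auto
  then show ?thesis using True by (simp add: top_unique)
next
  case False
  have l: "l > 0" using \<gamma> by (rule arclength_curve_pos)
  \<comment> \<open>Divergence is moved to the start of the curve, so that initial pieces of the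
    curve suffice to spread it to every point.\<close>
  have div0: "(\<Sum>n. e2ennreal \<bar>f n (\<gamma> 0)\<bar>) = top"
    using div suminf_abs_le_along_curve(2)[of G f, OF ug \<gamma>] False by (auto simp: top_unique)
  have inD: "\<gamma> b \<in> D" if b: "b \<in> {0..l}" for b
  proof (cases "b = 0")
    case False
    have \<gamma>b: "arclength_curve \<gamma> b" using arclength_curve_initial[OF \<gamma>] b False by simp
    have "(\<integral>\<^sup>+t\<in>{0..b}. (\<Sum>n. G n (\<gamma> t)) \<partial>lborel) \<le> (\<integral>\<^sup>+t\<in>{0..l}. (\<Sum>n. G n (\<gamma> t)) \<partial>lborel)"
      using b by (intro nn_integral_mono mult_left_mono) (auto simp: indicator_def)
    then have "(\<integral>\<^sup>+t\<in>{0..b}. (\<Sum>n. G n (\<gamma> t)) \<partial>lborel) \<noteq> top"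
      using \<open>_ \<noteq> top\<close> by (auto simp: top_unique)
    then show ?thesis
      using suminf_abs_le_along_curve(1)[of G f, OF ug \<gamma>b] div0 by (intro D(2)) (auto simp: top_unique)
  qed (use D(2) div0 in simp)
  \<comment> \<open>The summand with value \<open>top\<close> on \<open>D\<close> is now integrated
    over a parameter interval of positive length \<open>l\<close>.\<close>
  have "top = top * emeasure lborel {0..l}" using l by (simp add: ennreal_top_mult)
  also have "\<dots> = (\<integral>\<^sup>+t. top * indicator {0..l} t \<partial>lborel)"
    by (rule nn_integral_cmult_indicator[symmetric]) simp
  also have "\<dots> \<le> (\<integral>\<^sup>+t\<in>{0..l}. ((\<Sum>n. G n (\<gamma> t)) + top * indicator D (\<gamma> t)) \<partial>lborel)"
    using inD by (intro nn_integral_mono) (auto simp: indicator_def)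
  finally show ?thesis by (simp add: top_unique)
qed

section \<open>Real sequences with summable increments\<close>

lemma convergent_of_suminf_increments:
  fixes r :: "nat \<Rightarrow> real"
  assumes "(\<Sum>n. ennreal \<bar>r (Suc n) - r n\<bar>) \<noteq> top"
  shows "convergent r"
proof -
  have "summable (\<lambda>n. \<bar>r (Suc n) - r n\<bar>)"
    by (rule summable_suminf_not_top) (use assms in auto)
  then have "summable (\<lambda>n. r (Suc n) - r n)" by (rule summable_rabs_cancel)
  then have "convergent (\<lambda>n. \<Sum>i<n. r (Suc i) - r i)" by (simp add: summable_iff_convergent)
  then have "convergent (\<lambda>n. (r n - r 0) + r 0)"
    unfolding sum_lessThan_telescope by (intro convergent_add convergent_const)
  then show ?thesis by simp
qed

text \<open>Telescoping bounds the finite differences, and the bound survives the limit. It is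
  applied both to the values at one point and to the differences of the values at two
  endpoints.\<close>

lemma limit_diff_le_suminf_increments:
  fixes r :: "nat \<Rightarrow> real"
  assumes "r \<longlonglongrightarrow> L"
  shows "ennreal \<bar>L - r k\<bar> \<le> (\<Sum>j. ennreal \<bar>r (Suc (j + k)) - r (j + k)\<bar>)"
proof (rule LIMSEQ_le_const2)
  show "(\<lambda>n. ennreal \<bar>r (n + k) - r k\<bar>) \<longlonglongrightarrow> ennreal \<bar>L - r k\<bar>"
    by (intro tendsto_intros LIMSEQ_ignore_initial_segment assms)
  have "ennreal \<bar>r (n + k) - r k\<bar> \<le> (\<Sum>j. ennreal \<bar>r (Suc (j + k)) - r (j + k)\<bar>)" for n
  proof -
    have "r (n + k) - r k = (\<Sum>j<n. r (Suc (j + k)) - r (j + k))"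
      using sum_lessThan_telescope[of "\<lambda>j. r (j + k)" n] by simp
    then have "ennreal \<bar>r (n + k) - r k\<bar> \<le> ennreal (\<Sum>j<n. \<bar>r (Suc (j + k)) - r (j + k)\<bar>)"
      by (simp add: ennreal_leI)
    also have "\<dots> = (\<Sum>j<n. ennreal \<bar>r (Suc (j + k)) - r (j + k)\<bar>)" by (simp add: sum_ennreal)
    also have "\<dots> \<le> (\<Sum>j. ennreal \<bar>r (Suc (j + k)) - r (j + k)\<bar>)" by (rule sum_le_suminf) auto
    finally show ?thesis .
  qed
  then show "\<exists>N. \<forall>n\<ge>N. ennreal \<bar>r (n + k) - r k\<bar> \<le> (\<Sum>j. ennreal \<bar>r (Suc (j + k)) - r (j + k)\<bar>)"
    by blast
qed

section \<open>The telescoping series of a sequence of functions and its pointwise limit\<close>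

definition increments :: "(nat \<Rightarrow> 'a \<Rightarrow> ereal) \<Rightarrow> nat \<Rightarrow> 'a \<Rightarrow> ereal" where
  "increments u n = (case n of 0 \<Rightarrow> u 0 | Suc j \<Rightarrow> fun_diff (u (Suc j)) (u j))"

definition total_increment :: "(nat \<Rightarrow> 'a \<Rightarrow> ereal) \<Rightarrow> 'a \<Rightarrow> ennreal" where
  "total_increment u x = (\<Sum>n. e2ennreal \<bar>increments u n x\<bar>)"

text \<open>Passing to reals loses nothing: where the total increment is finite, every
  \<open>u k x\<close> is finite and the real sequence converges.\<close>

definition increment_limit :: "(nat \<Rightarrow> 'a \<Rightarrow> ereal) \<Rightarrow> 'a \<Rightarrow> ereal" where
  "increment_limit u x =
    (if total_increment u x = top then 0 else ereal (lim (\<lambda>k. real_of_ereal (u k x))))"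

lemma increments_measurable [measurable]:
  "(\<And>n. u n \<in> borel_measurable M) \<Longrightarrow> increments u n \<in> borel_measurable M"
  by (cases n) (auto simp: increments_def)

lemma total_increment_measurable [measurable]:
  assumes [measurable]: "\<And>n. u n \<in> borel_measurable M"
  shows "total_increment u \<in> borel_measurable M"
proof -
  have [measurable]: "increments u n \<in> borel_measurable M" for n by measurable
  show ?thesis unfolding total_increment_def by measurable
qed

lemma increment_limit_measurable [measurable]:
  assumes [measurable]: "\<And>n. u n \<in> borel_measurable M"
  shows "increment_limit u \<in> borel_measurable M"
  unfolding increment_limit_def by measurable

lemma e2ennreal_abs_eq_top_iff: "e2ennreal \<bar>a\<bar> = top \<longleftrightarrow> \<bar>a\<bar> = \<infinity>"
  by (cases a) auto

lemma increments_finite: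
  assumes "total_increment u x \<noteq> top"
  shows "\<bar>increments u n x\<bar> \<noteq> \<infinity>"
  using ennreal_suminf_lessD[of "\<lambda>n. e2ennreal \<bar>increments u n x\<bar>" top n] assms
  by (simp add: total_increment_def less_top e2ennreal_abs_eq_top_iff flip: less_top)

text \<open>Finite increments alone would not suffice, because \<open>fun_diff\<close> gives 0 for
  two equal infinite values. The induction starts from the zeroth increment, which is
  \<open>u 0\<close> itself.\<close>

lemma total_increment_finite:
  assumes fin: "total_increment u x \<noteq> top"
  shows "\<bar>u k x\<bar> \<noteq> \<infinity>"
proof (induction k)
  case 0
  show ?case using increments_finite[OF fin, of 0] by (simp add: increments_def)
next
  case (Suc k)
  then show ?case using increments_finite[OF fin, of "Suc k"]
    by (cases "u k x"; cases "u (Suc k) x") (auto simp: increments_def fun_diff_def fun_add_def)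
qed

lemma fun_diff_real:
  assumes "\<bar>u x\<bar> \<noteq> \<infinity>" "\<bar>v x\<bar> \<noteq> \<infinity>"
  shows "fun_diff u v x = ereal (real_of_ereal (u x) - real_of_ereal (v x))"
  using assms by (cases "u x"; cases "v x") (auto simp: fun_diff_def fun_add_def)

lemma increments_Suc_real:
  assumes "total_increment u x \<noteq> top"
  shows "increments u (Suc j) x = ereal (real_of_ereal (u (Suc j) x) - real_of_ereal (u j x))"
  using total_increment_finite[OF assms] by (simp add: increments_def fun_diff_real)

lemma tendsto_increment_limit:
  assumes fin: "total_increment u x \<noteq> top"
  shows "(\<lambda>k. real_of_ereal (u k x)) \<longlonglongrightarrow> real_of_ereal (increment_limit u x)"
proof -
  let ?r = "\<lambda>k. real_of_ereal (u k x)"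
  have "(\<Sum>n. ennreal \<bar>?r (Suc n) - ?r n\<bar>) = (\<Sum>n. e2ennreal \<bar>increments u (Suc n) x\<bar>)"
    by (simp add: increments_Suc_real[OF fin])
  also have "\<dots> \<noteq> top"
    using suminf_offset[of "\<lambda>n. e2ennreal \<bar>increments u n x\<bar>" 1] fin
    by (auto simp: total_increment_def)
  finally have "convergent ?r" by (rule convergent_of_suminf_increments)
  then show ?thesis using fin by (simp add: increment_limit_def convergent_LIMSEQ_iff)
qed

lemma increment_limit_diff_real:
  assumes "total_increment u x \<noteq> top"
  shows "fun_diff (increment_limit u) (u k) x =
    ereal (real_of_ereal (increment_limit u x) - real_of_ereal (u k x))"
  by (rule fun_diff_real) (simp_all add: total_increment_finite[OF assms] increment_limit_def)

lemma increment_limit_diff_le: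
  assumes fin: "total_increment u x \<noteq> top"
  shows "e2ennreal \<bar>fun_diff (increment_limit u) (u k) x\<bar> \<le>
    (\<Sum>j. e2ennreal \<bar>increments u (Suc (j + k)) x\<bar>)"
  using limit_diff_le_suminf_increments[OF tendsto_increment_limit[OF fin], of k]
  by (simp add: increment_limit_diff_real[OF fin] increments_Suc_real[OF fin])

lemma increment_limit_diff_diff_le:
  assumes fin: "total_increment u x \<noteq> top" "total_increment u y \<noteq> top"
  shows "e2ennreal \<bar>fun_diff (increment_limit u) (u k) x - fun_diff (increment_limit u) (u k) y\<bar> \<le>
    (\<Sum>j. e2ennreal \<bar>increments u (Suc (j + k)) x - increments u (Suc (j + k)) y\<bar>)"
  using limit_diff_le_suminf_increments[OF
      tendsto_diff[OF tendsto_increment_limit[OF fin(1)] tendsto_increment_limit[OF fin(2)]], of k]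
  by (simp add: increment_limit_diff_real fin increments_Suc_real algebra_simps)

text \<open>The tail handles curves with convergence at both endpoints; on the others any positive
  multiple of the second summand integrates to \<open>top\<close>. Keeping \<open>\<epsilon>\<close>
  free allows that summand to be made small in norm later.\<close>

lemma upper_gradient_increment_limit_diff:
  fixes G :: "nat \<Rightarrow> 'a::metric_space \<Rightarrow> ennreal"
  assumes ug: "\<And>n. upper_gradient (G n) (increments u n)"
    and D: "D \<in> sets borel" "\<And>x. total_increment u x = top \<Longrightarrow> x \<in> D"
    and \<epsilon>: "\<epsilon> > 0"
  shows "upper_gradient
    (\<lambda>x. (\<Sum>j. G (Suc (j + k)) x) + ennreal \<epsilon> * ((\<Sum>n. G n x) + top * indicator D x))
    (fun_diff (increment_limit u) (u k))" (is "upper_gradient ?g ?w")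
  unfolding upper_gradient_def
proof (intro conjI allI impI)
  have [measurable]: "G n \<in> borel_measurable borel" for n
    using ug by (simp add: upper_gradient_def)
  note D(1)[measurable]
  let ?\<rho> = "\<lambda>x. (\<Sum>n. G n x) + top * indicator D x"
  have m: "?\<rho> \<in> borel_measurable borel" by measurable
  show "?g \<in> borel_measurable borel" by measurable
  fix \<gamma> :: "real \<Rightarrow> 'a" and l
  assume \<gamma>: "arclength_curve \<gamma> l"
  show "e2ennreal \<bar>?w (\<gamma> 0) - ?w (\<gamma> l)\<bar> \<le> (\<integral>\<^sup>+t\<in>{0..l}. ?g (\<gamma> t) \<partial>lborel)"
  proof (cases "total_increment u (\<gamma> 0) = top \<or> total_increment u (\<gamma> l) = top")
    case True
    then have "(\<integral>\<^sup>+t\<in>{0..l}. ?\<rho> (\<gamma> t) \<partial>lborel) = top"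
      using nn_integral_along_curve_eq_top[OF ug \<gamma> D(1) D(2)[unfolded total_increment_def]]
      by (simp add: total_increment_def)
    then have "top = (\<integral>\<^sup>+t. ennreal \<epsilon> * (?\<rho> (\<gamma> t) * indicator {0..l} t) \<partial>lborel)"
      using borel_measurable_along_curve[OF \<gamma> m] \<epsilon>
      by (subst nn_integral_cmult) (auto simp: ennreal_mult_top)
    also have "\<dots> \<le> (\<integral>\<^sup>+t\<in>{0..l}. ?g (\<gamma> t) \<partial>lborel)"
      by (intro nn_integral_mono) (auto simp: indicator_def)
    finally show ?thesis by (simp add: top_unique)
  next
    case False
    then have "e2ennreal \<bar>?w (\<gamma> 0) - ?w (\<gamma> l)\<bar> \<le>
        (\<Sum>j. e2ennreal \<bar>increments u (Suc (j + k)) (\<gamma> 0) - increments u (Suc (j + k)) (\<gamma> l)\<bar>)"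
      by (intro increment_limit_diff_diff_le) auto
    also have "\<dots> \<le> (\<Sum>j. \<integral>\<^sup>+t\<in>{0..l}. G (Suc (j + k)) (\<gamma> t) \<partial>lborel)"
      using ug \<gamma> by (intro suminf_le summableI) (auto simp: upper_gradient_def)
    also have "\<dots> = (\<integral>\<^sup>+t\<in>{0..l}. (\<Sum>j. G (Suc (j + k)) (\<gamma> t)) \<partial>lborel)"
      by (intro nn_integral_along_curve_suminf[symmetric] \<gamma>) measurable
    also have "\<dots> \<le> (\<integral>\<^sup>+t\<in>{0..l}. ?g (\<gamma> t) \<partial>lborel)"
      by (intro nn_integral_mono mult_right_mono) auto
    finally show ?thesis .
  qed
qed

section \<open>The lattice quasinorm on nonnegative functions\<close>

context quasi_banach_function_lattice
begin

text \<open>Upper gradients and moduli live in \<open>ennreal\<close>, where sums and series are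
  always defined and the convention for \<open>\<infinity> - \<infinity>\<close> never
  intervenes.\<close>

abbreviation nE :: "('a \<Rightarrow> ennreal) \<Rightarrow> ennreal" where
  "nE g \<equiv> nX (\<lambda>x. enn2ereal (g x))"

lemma upper_gradient_measurable: "upper_gradient g u \<Longrightarrow> g \<in> borel_measurable M"
  using borel_sets space_eq_UNIV by (auto simp: upper_gradient_def measurable_def)

lemma nX_eq_nE:
  assumes [measurable]: "u \<in> borel_measurable M"
  shows "nX u = nE (\<lambda>x. e2ennreal \<bar>u x\<bar>)"
  by (intro norm_cong) (auto simp: enn2ereal_e2ennreal)

lemma nE_mono:
  assumes [measurable]: "g \<in> borel_measurable M" "h \<in> borel_measurable M"
    and le: "AE x in M. g x \<le> h x"
  shows "nE g \<le> nE h"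
  using le by (intro norm_mono) (auto simp: less_eq_ennreal.rep_eq)

lemma nE_add:
  assumes [measurable]: "g \<in> borel_measurable M" "h \<in> borel_measurable M"
  shows "nE (\<lambda>x. g x + h x) \<le> ennreal c * (nE g + nE h)"
proof -
  have "(\<lambda>x. enn2ereal (g x + h x)) = fun_add (\<lambda>x. enn2ereal (g x)) (\<lambda>x. enn2ereal (h x))"
  proof
    fix x
    show "enn2ereal (g x + h x) = fun_add (\<lambda>x. enn2ereal (g x)) (\<lambda>x. enn2ereal (h x)) x"
      using enn2ereal_nonneg[of "g x"] enn2ereal_nonneg[of "h x"]
      by (cases "enn2ereal (g x)"; cases "enn2ereal (h x)") (auto simp: fun_add_def plus_ennreal.rep_eq)
  qed
  then show ?thesis using norm_add[of "\<lambda>x. enn2ereal (g x)" "\<lambda>x. enn2ereal (h x)"] by simp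
qed

lemma nE_scale:
  assumes [measurable]: "g \<in> borel_measurable M" and "a \<ge> 0"
  shows "nE (\<lambda>x. ennreal a * g x) = ennreal a * nE g"
  using norm_scale[of "\<lambda>x. enn2ereal (g x)" a] assms(2)
  by (simp add: times_ennreal.rep_eq enn2ereal_ennreal)

lemma nE_suminf:
  assumes [measurable]: "\<And>n. g n \<in> borel_measurable M"
  shows "nE (\<lambda>x. \<Sum>n. g n x) \<le> (\<Sum>n. ennreal c ^ Suc n * nE (g n))"
  by (rule riesz_fischer) auto

lemma nE_null:
  assumes [measurable]: "g \<in> borel_measurable M" and "AE x in M. g x = 0"
  shows "nE g = 0"
  using assms(2) by (subst norm_eq_0_iff) (auto elim: eventually_mono simp: zero_ennreal.rep_eq)

text \<open>
  The function \<open>h = \<infinity> \<cdot> 1\<^bsub>{g = \<infinity>}\<^esub>\<close> satisfies \<open>2 h = h\<close>, so its norm is 0 or \<open>\<infinity>\<close>.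
\<close>

lemma nE_finite_imp_AE_finite:
  assumes [measurable]: "g \<in> borel_measurable M" and fin: "nE g \<noteq> top"
  shows "AE x in M. g x \<noteq> top"
proof -
  let ?h = "\<lambda>x. if g x = top then top else 0 :: ennreal"
  have "nE ?h \<le> nE g" by (intro nE_mono AE_I2) auto
  then have "nE ?h \<noteq> top" using fin by (auto simp: top_unique)
  have "nE ?h = nE (\<lambda>x. ennreal 2 * ?h x)"
    by (intro arg_cong[where f = nX] ext) (auto simp: ennreal_mult_top)
  also have "\<dots> = ennreal 2 * nE ?h" by (rule nE_scale) auto
  also have "\<dots> = nE ?h + nE ?h" by (simp add: mult_2)
  finally have "nE ?h + nE ?h = nE ?h + 0" by (simp only: add_0_right)
  then have "nE ?h = 0" using \<open>nE ?h \<noteq> top\<close> by (simp add: ennreal_add_left_cancel)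
  then have "AE x in M. enn2ereal (?h x) = 0" by (subst (asm) norm_eq_0_iff) auto
  then show ?thesis by eventually_elim (auto split: if_splits)
qed

text \<open>The factor \<open>c ^ Suc j\<close> from Riesz-Fischer cancels against the assumed
  bound, leaving \<open>(1 / 2) ^ k * (1 / 2) ^ Suc j * (1 / c) ^ k\<close>. The last factor is at
  most 1, and the rest sums to \<open>(1 / 2) ^ k\<close>.\<close>

lemma nE_suminf_geometric:
  assumes [measurable]: "\<And>n. g n \<in> borel_measurable M"
    and le: "\<And>j. nE (g j) \<le> ennreal ((1 / (2 * c)) ^ Suc (j + k))"
  shows "nE (\<lambda>x. \<Sum>j. g j x) \<le> ennreal ((1 / 2) ^ k)"
proof -
  have c: "c > 0" using c_ge_1 by simp
  have "nE (\<lambda>x. \<Sum>j. g j x) \<le> (\<Sum>j. ennreal c ^ Suc j * nE (g j))" by (rule nE_suminf) measurable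
  also have "\<dots> \<le> (\<Sum>j. ennreal ((1 / 2) ^ k * (1 / 2) ^ Suc j))"
  proof (intro suminf_le summableI)
    fix j
    have "ennreal c ^ Suc j * nE (g j) \<le> ennreal c ^ Suc j * ennreal ((1 / (2 * c)) ^ Suc (j + k))"
      by (intro mult_left_mono le) simp
    also have "\<dots> = ennreal (c ^ Suc j * (1 / (2 * c)) ^ Suc (j + k))"
      using c by (simp add: ennreal_power ennreal_mult del: power_Suc)
    also have "c ^ Suc j * (1 / (2 * c)) ^ Suc (j + k) = (1 / 2) ^ k * (1 / 2) ^ Suc j * (1 / c) ^ k"
      using c by (simp add: power_add power_mult_distrib power_divide field_simps)
    also have "\<dots> \<le> (1 / 2) ^ k * (1 / 2) ^ Suc j * 1"
      using c_ge_1 by (intro mult_left_mono power_le_one) auto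
    finally show "ennreal c ^ Suc j * nE (g j) \<le> ennreal ((1 / 2) ^ k * (1 / 2) ^ Suc j)"
      by (simp add: ennreal_leI)
  qed
  also have "\<dots> = ennreal ((1 / 2) ^ k)"
    using sums_mult[OF power_half_series, of "(1 / 2) ^ k"] by (intro suminf_ennreal_eq) auto
  finally show ?thesis .
qed

text \<open>The zeroth term is merely finite, not small, so it is split off; the geometric bound
  with \<open>k = 0\<close> covers the remaining series.\<close>

lemma nE_suminf_finite:
  assumes [measurable]: "\<And>n. g n \<in> borel_measurable M"
    and "nE (g 0) \<noteq> top" and "\<And>j. nE (g (Suc j)) \<le> ennreal ((1 / (2 * c)) ^ Suc j)"
  shows "nE (\<lambda>x. \<Sum>n. g n x) \<noteq> top"
proof -
  have "(\<Sum>n. g n x) = g 0 x + (\<Sum>j. g (Suc j) x)" for x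
    using suminf_offset[of "\<lambda>n. g n x" 1] by (simp add: add.commute)
  then have "nE (\<lambda>x. \<Sum>n. g n x) \<le> ennreal c * (nE (g 0) + nE (\<lambda>x. \<Sum>j. g (Suc j) x))"
    using nE_add[of "g 0" "\<lambda>x. \<Sum>j. g (Suc j) x"] by simp
  also have "\<dots> \<le> ennreal c * (nE (g 0) + ennreal ((1 / 2) ^ 0))"
    using assms by (intro mult_left_mono add_left_mono nE_suminf_geometric) auto
  also have "\<dots> < top" using assms(2) by (auto simp: ennreal_mult_less_top less_top)
  finally show ?thesis by simp
qed

section \<open>The quasi-triangle inequality for the Newtonian quasinorm\<close>

lemma newton_norm_triangle:
  assumes [measurable]: "u \<in> borel_measurable M" "v \<in> borel_measurable M" "w \<in> borel_measurable M"
  shows "newton_norm nX (fun_diff u w) \<le>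
    ennreal c * (newton_norm nX (fun_diff u v) + newton_norm nX (fun_diff v w))"
proof -
  let ?I = "\<lambda>u. INF g\<in>{g. upper_gradient g u}. nE g"
  have le: "e2ennreal \<bar>fun_diff u w x\<bar> \<le> e2ennreal \<bar>fun_diff u v x\<bar> + e2ennreal \<bar>fun_diff v w x\<bar>" for x
  proof -
    have "\<bar>fun_diff u w x\<bar> \<le> \<bar>fun_diff u v x\<bar> + \<bar>fun_diff v w x\<bar>"
      by (cases "u x"; cases "v x"; cases "w x") (auto simp: fun_diff_def fun_add_def)
    then have "e2ennreal \<bar>fun_diff u w x\<bar> \<le> e2ennreal (\<bar>fun_diff u v x\<bar> + \<bar>fun_diff v w x\<bar>)"
      by (rule e2ennreal_mono)
    then show ?thesis by (simp add: e2ennreal_plus)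
  qed
  have "nX (fun_diff u w) = nE (\<lambda>x. e2ennreal \<bar>fun_diff u w x\<bar>)" by (intro nX_eq_nE) measurable
  also have "\<dots> \<le> nE (\<lambda>x. e2ennreal \<bar>fun_diff u v x\<bar> + e2ennreal \<bar>fun_diff v w x\<bar>)"
    using le by (intro nE_mono) auto
  also have "\<dots> \<le> ennreal c * (nX (fun_diff u v) + nX (fun_diff v w))"
    using nE_add[of "\<lambda>x. e2ennreal \<bar>fun_diff u v x\<bar>" "\<lambda>x. e2ennreal \<bar>fun_diff v w x\<bar>"]
    by (simp add: nX_eq_nE[of "fun_diff u v"] nX_eq_nE[of "fun_diff v w"])
  finally have 1: "nX (fun_diff u w) \<le> ennreal c * (nX (fun_diff u v) + nX (fun_diff v w))" .
  have 2: "?I (fun_diff u w) \<le> ennreal c * (?I (fun_diff u v) + ?I (fun_diff v w))"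
  proof (rule ennreal_le_epsilon)
    fix e :: real
    assume fin: "ennreal c * (?I (fun_diff u v) + ?I (fun_diff v w)) < top" and e: "e > 0"
    have c: "c > 0" using c_ge_1 by simp
    \<comment> \<open>The infima need not be attained, so near-optimal upper gradients are chosen
      with slack \<open>d\<close> each. After multiplication by \<open>c\<close> the two slacks
      amount to \<open>e\<close>.\<close>
    define d where "d = ennreal (e / (2 * c))"
    have d: "d > 0" "ennreal c * (d + d) = ennreal e"
      using e c by (simp_all add: d_def flip: ennreal_plus ennreal_mult)
    have "?I (fun_diff u v) < top" "?I (fun_diff v w) < top"
      using fin c by (auto simp: ennreal_mult_less_top)
    then have "?I (fun_diff u v) < ?I (fun_diff u v) + d" "?I (fun_diff v w) < ?I (fun_diff v w) + d"
      using d by (simp_all add: ennreal_add_left_cancel_less less_top[symmetric])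
    then obtain g h where g: "upper_gradient g (fun_diff u v)" "nE g < ?I (fun_diff u v) + d"
      and h: "upper_gradient h (fun_diff v w)" "nE h < ?I (fun_diff v w) + d"
      by (metis (no_types, lifting) INF_less_iff mem_Collect_eq)
    have [measurable]: "g \<in> borel_measurable M" "h \<in> borel_measurable M"
      using upper_gradient_measurable[OF g(1)] upper_gradient_measurable[OF h(1)] .
    have "?I (fun_diff u w) \<le> nE (\<lambda>x. g x + h x)"
      using upper_gradient_diff_add[OF g(1) h(1)] by (intro INF_lower) simp
    also have "\<dots> \<le> ennreal c * (nE g + nE h)" by (rule nE_add) measurable
    also have "\<dots> \<le> ennreal c * ((?I (fun_diff u v) + d) + (?I (fun_diff v w) + d))"
      using g h by (intro mult_left_mono add_mono) auto
    also have "\<dots> = ennreal c * (?I (fun_diff u v) + ?I (fun_diff v w)) + ennreal c * (d + d)"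
      by (simp add: algebra_simps)
    finally show "?I (fun_diff u w) \<le>
        ennreal c * (?I (fun_diff u v) + ?I (fun_diff v w)) + ennreal e"
      by (simp only: d)
  qed
  show ?thesis
    using add_mono[OF 1 2] by (simp add: newton_norm_def algebra_simps)
qed

text \<open>The triangle inequality with the zero function as third point; it will place the limit
  in the Newtonian space.\<close>

lemma newton_space_of_diff:
  assumes u: "u \<in> newton_space M nX" and w: "w \<in> borel_measurable M"
    and fin: "newton_norm nX (fun_diff w u) < top"
  shows "w \<in> newton_space M nX"
proof -
  have "fun_diff v (\<lambda>_. 0) = v" for v :: "'a \<Rightarrow> ereal"
    by (auto simp: fun_diff_def fun_add_def fun_eq_iff)
  then have "newton_norm nX w \<le> ennreal c * (newton_norm nX (fun_diff w u) + newton_norm nX u)"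
    using newton_norm_triangle[of w u "\<lambda>_. 0"] u w by (simp add: newton_space_def)
  also have "\<dots> < top" using u fin by (auto simp: newton_space_def ennreal_mult_less_top less_top)
  finally show ?thesis using w by (simp add: newton_space_def)
qed

lemma upper_gradient_norm_less:
  assumes "newton_norm nX u < e"
  shows "\<exists>g. upper_gradient g u \<and> nE g < e"
proof -
  have "(INF g\<in>{g. upper_gradient g u}. nE g) \<le> newton_norm nX u"
    by (simp add: newton_norm_def)
  then have "(INF g\<in>{g. upper_gradient g u}. nE g) < e" using assms by (rule le_less_trans)
  then show ?thesis by (auto simp: INF_less_iff)
qed

section \<open>Completeness on the level of functions\<close>

lemma fast_cauchy_converges:
  assumes u: "\<And>n. u n \<in> newton_space M nX"
    and fast: "\<And>j. newton_norm nX (fun_diff (u (Suc j)) (u j)) < ennreal ((1 / (2 * c)) ^ Suc j)"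
  obtains w where "w \<in> newton_space M nX" "(\<lambda>k. newton_norm nX (fun_diff w (u k))) \<longlonglongrightarrow> 0"
proof -
  let ?f = "increments u"
  let ?w = "increment_limit u"
  have um [measurable]: "u n \<in> borel_measurable M" for n using u by (simp add: newton_space_def)
  have f0: "newton_norm nX (?f 0) < top" using u[of 0] by (simp add: increments_def newton_space_def)
  have fS: "newton_norm nX (?f (Suc j)) < ennreal ((1 / (2 * c)) ^ Suc j)" for j
    using fast[of j] by (simp only: increments_def nat.case)
  \<comment> \<open>One strict bound for all indices allows a uniform choice of upper gradients; at
    index 0 it only demands finite norm.\<close>
  define e where "e n = (case n of 0 \<Rightarrow> top | Suc j \<Rightarrow> ennreal ((1 / (2 * c)) ^ Suc j))" for n
  have "newton_norm nX (?f n) < e n" for n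
    using f0 fS by (cases n) (auto simp only: e_def nat.case)
  then have "\<exists>g. upper_gradient g (?f n) \<and> nE g < e n" for n
    by (rule upper_gradient_norm_less)
  then obtain G where ug: "\<And>n. upper_gradient (G n) (?f n)" and nG: "\<And>n. nE (G n) < e n"
    by metis
  have nG0: "nE (G 0) \<noteq> top" using nG[of 0] by (auto simp: e_def)
  have nGS: "nE (G (Suc j)) \<le> ennreal ((1 / (2 * c)) ^ Suc j)" for j
    using nG[of "Suc j"] by (simp add: e_def del: power_Suc)
  have [measurable]: "G n \<in> borel_measurable M" for n
    using ug by (rule upper_gradient_measurable)
  have fm [measurable]: "?f n \<in> borel_measurable M" for n by measurable
  let ?a = "\<lambda>n x. e2ennreal \<bar>?f n x\<bar>"
  have na: "nE (?a n) \<le> newton_norm nX (?f n)" for n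
    unfolding nX_eq_nE[OF fm, symmetric] by (simp add: newton_norm_def)
  have naS: "nE (?a (Suc j)) \<le> ennreal ((1 / (2 * c)) ^ Suc j)" for j
    using na fS by (meson less_imp_le order_trans)
  have na0: "nE (?a 0) \<noteq> top" using na[of 0] f0 by (auto simp: top_unique)
  have "nE (\<lambda>x. \<Sum>n. ?a n x) \<noteq> top"
    by (rule nE_suminf_finite[OF _ na0 naS]) measurable
  then have fin: "AE x in M. total_increment u x \<noteq> top"
    unfolding total_increment_def by (intro nE_finite_imp_AE_finite) measurable
  define A where "A = {x. total_increment u x = top}"
  have "A = {x \<in> space M. total_increment u x = top}" by (simp add: A_def space_eq_UNIV)
  then have A [measurable]: "A \<in> sets M" by simp
  have "emeasure M A = 0" using fin A by (simp add: A_def AE_iff_measurable space_eq_UNIV)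
  \<comment> \<open>Upper gradients must be Borel, whereas \<open>A\<close> is only
    \<open>M\<close>-measurable; Borel regularity supplies the hull.\<close>
  then obtain D where D: "D \<in> sets borel" "A \<subseteq> D" "emeasure M D = 0"
    using borel_hull[OF A] by auto
  have [measurable]: "D \<in> sets M" using D borel_sets by auto
  define \<rho> where "\<rho> x = (\<Sum>n. G n x) + top * indicator D x" for x
  have [measurable]: "\<rho> \<in> borel_measurable M" unfolding \<rho>_def by measurable
  \<comment> \<open>The infinite values placed on \<open>D\<close> do not affect the norm of
    \<open>\<rho>\<close>, since \<open>D\<close> is null.\<close>
  have "AE x in M. x \<notin> D" using D by (intro AE_not_in) (simp add: null_sets_def)
  then have "nE \<rho> \<le> nE (\<lambda>x. \<Sum>n. G n x)"
    by (intro nE_mono) (auto elim!: eventually_mono simp: \<rho>_def)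
  moreover have "nE (\<lambda>x. \<Sum>n. G n x) \<noteq> top"
    by (rule nE_suminf_finite[OF _ nG0 nGS]) measurable
  ultimately have n\<rho>: "nE \<rho> \<noteq> top" by (auto simp: top_unique)
  have wm [measurable]: "?w \<in> borel_measurable M" by measurable
  \<comment> \<open>The summand 1 accounts for the function itself. The other accounts for its upper
    gradient: the tail and the multiple of \<open>\<rho>\<close>, joined by the quasi-triangle
    inequality with \<open>\<epsilon> = (1 / 2) ^ k\<close>.\<close>
  define C where "C = 1 + ennreal c * (1 + nE \<rho>)"
  have C: "C \<noteq> top" using n\<rho> by (auto simp: C_def ennreal_mult_eq_top_iff)
  have bound: "newton_norm nX (fun_diff ?w (u k)) \<le> C * ennreal ((1 / 2) ^ k)" for k
  proof -
    let ?\<epsilon> = "ennreal ((1 / 2) ^ k)"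
    have "nX (fun_diff ?w (u k)) = nE (\<lambda>x. e2ennreal \<bar>fun_diff ?w (u k) x\<bar>)"
      by (intro nX_eq_nE) measurable
    also have "\<dots> \<le> nE (\<lambda>x. \<Sum>j. ?a (Suc (j + k)) x)"
      using fin by (intro nE_mono) (auto elim!: eventually_mono intro: increment_limit_diff_le)
    also have "\<dots> \<le> ?\<epsilon>" by (rule nE_suminf_geometric) (measurable, rule naS)
    finally have 1: "nX (fun_diff ?w (u k)) \<le> ?\<epsilon>" .
    let ?g = "\<lambda>x. (\<Sum>j. G (Suc (j + k)) x) + ?\<epsilon> * \<rho> x"
    have "upper_gradient ?g (fun_diff ?w (u k))"
      unfolding \<rho>_def using D(2)
      by (intro upper_gradient_increment_limit_diff ug D(1)) (auto simp: A_def)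
    then have "(INF g\<in>{g. upper_gradient g (fun_diff ?w (u k))}. nE g) \<le> nE ?g"
      by (intro INF_lower) simp
    also have "\<dots> \<le> ennreal c * (nE (\<lambda>x. \<Sum>j. G (Suc (j + k)) x) + nE (\<lambda>x. ?\<epsilon> * \<rho> x))"
      by (rule nE_add) measurable
    also have "\<dots> \<le> ennreal c * (?\<epsilon> + ?\<epsilon> * nE \<rho>)"
    proof (intro mult_left_mono add_mono)
      show "nE (\<lambda>x. \<Sum>j. G (Suc (j + k)) x) \<le> ?\<epsilon>"
        by (rule nE_suminf_geometric) (measurable, rule nGS)
    qed (simp_all add: nE_scale)
    finally have 2: "(INF g\<in>{g. upper_gradient g (fun_diff ?w (u k))}. nE g) \<le>
      ennreal c * (?\<epsilon> + ?\<epsilon> * nE \<rho>)" .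
    show ?thesis
      using add_mono[OF 1 2] by (simp add: newton_norm_def C_def algebra_simps)
  qed
  have "(\<lambda>k. C * ennreal ((1 / 2) ^ k)) \<longlonglongrightarrow> C * ennreal 0"
    using C by (intro ennreal_tendsto_cmult tendsto_ennrealI LIMSEQ_power_zero) (auto simp: less_top)
  then have lim: "(\<lambda>k. C * ennreal ((1 / 2) ^ k)) \<longlonglongrightarrow> 0" by simp
  have "(\<lambda>k. newton_norm nX (fun_diff ?w (u k))) \<longlonglongrightarrow> 0"
    by (rule tendsto_sandwich[OF _ _ tendsto_const lim]) (use bound in auto)
  \<comment> \<open>The bound at \<open>k = 0\<close> puts the limit at finite distance from
    \<open>u 0\<close>, hence into the space.\<close>
  moreover have "newton_norm nX (fun_diff ?w (u 0)) < top"
    using bound[of 0] C by (auto simp: less_top[symmetric] top_unique)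
  then have "?w \<in> newton_space M nX" using u wm by (rule newton_space_of_diff[rotated 2])
  ultimately show ?thesis by (rule that[rotated])
qed

lemma cauchy_converges:
  assumes u: "\<And>n. u n \<in> newton_space M nX"
    and cauchy: "\<And>\<epsilon>. \<epsilon> > 0 \<Longrightarrow> \<exists>K. \<forall>m\<ge>K. \<forall>n\<ge>K. newton_norm nX (fun_diff (u m) (u n)) < \<epsilon>"
  obtains w where "w \<in> newton_space M nX" "(\<lambda>n. newton_norm nX (fun_diff (u n) w)) \<longlonglongrightarrow> 0"
proof -
  have um: "u n \<in> borel_measurable M" for n using u by (simp add: newton_space_def)
  have c: "c > 0" using c_ge_1 by simp
  have "\<exists>K. \<forall>m\<ge>K. \<forall>n\<ge>K. newton_norm nX (fun_diff (u m) (u n)) < ennreal ((1 / (2 * c)) ^ Suc j)" for j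
    using c by (intro cauchy) (simp del: power_Suc)
  then obtain K where K: "\<And>j m n. m \<ge> K j \<Longrightarrow> n \<ge> K j \<Longrightarrow>
      newton_norm nX (fun_diff (u m) (u n)) < ennreal ((1 / (2 * c)) ^ Suc j)"
    by metis
  \<comment> \<open>The sum makes \<open>s\<close> monotone and at least \<open>K j\<close>; the
    added \<open>j\<close> makes the indices unbounded, so that they pass every Cauchy
    threshold.\<close>
  define s where "s j = j + (\<Sum>i\<le>j. K i)" for j
  have s: "K j \<le> s j" "j \<le> s j" "s j \<le> s (Suc j)" for j
    by (auto simp: s_def intro: trans_le_add2 member_le_sum)
  have "newton_norm nX (fun_diff (u (s (Suc j))) (u (s j))) < ennreal ((1 / (2 * c)) ^ Suc j)" for j
    using s(1)[of j] s(3)[of j] by (intro K) auto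
  then obtain w where w: "w \<in> newton_space M nX"
    and lim: "(\<lambda>k. newton_norm nX (fun_diff w (u (s k)))) \<longlonglongrightarrow> 0"
    using fast_cauchy_converges[of "\<lambda>k. u (s k)"] u by blast
  have wm: "w \<in> borel_measurable M" using w by (simp add: newton_space_def)
  have "(\<lambda>n. newton_norm nX (fun_diff (u n) w)) \<longlonglongrightarrow> 0"
  proof (rule order_tendstoI)
    fix e :: ennreal
    assume e: "0 < e"
    \<comment> \<open>As \<open>e\<close> may be infinite, a positive real \<open>d\<close> below it
      is taken. The two distances to \<open>u (s k)\<close> are then kept below
      \<open>d / (2 * c)\<close> each, to absorb the factor \<open>c\<close> of the triangle
      inequality.\<close>
    obtain x where "0 < x" "x < e" using dense[OF e] by blast
    then obtain d where d: "d > 0" "ennreal d < e" by (cases x) auto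
    define \<delta> where "\<delta> = ennreal (d / (2 * c))"
    have \<delta>: "\<delta> > 0" "ennreal c * (\<delta> + \<delta>) = ennreal d"
      using d c by (simp_all add: \<delta>_def flip: ennreal_plus ennreal_mult)
    obtain N where N: "\<And>m n. m \<ge> N \<Longrightarrow> n \<ge> N \<Longrightarrow> newton_norm nX (fun_diff (u m) (u n)) < \<delta>"
      using cauchy[OF \<delta>(1)] by blast
    have "eventually (\<lambda>k. newton_norm nX (fun_diff w (u (s k))) < \<delta> \<and> k \<ge> N) sequentially"
      using order_tendstoD(2)[OF lim \<delta>(1)] eventually_ge_at_top by (rule eventually_conj)
    then obtain k where k: "newton_norm nX (fun_diff w (u (s k))) < \<delta>" "k \<ge> N"
      by (auto dest: eventually_happens)
    have "newton_norm nX (fun_diff (u n) w) < e" if "n \<ge> N" for n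
    proof -
      have "newton_norm nX (fun_diff (u n) w) \<le> ennreal c *
          (newton_norm nX (fun_diff (u n) (u (s k))) + newton_norm nX (fun_diff (u (s k)) w))"
        by (intro newton_norm_triangle um wm)
      also have "\<dots> \<le> ennreal c * (\<delta> + \<delta>)"
        using N[of n "s k"] that k s(2)[of k] newton_norm_diff_commute[OF wm um[of "s k"]]
        by (intro mult_left_mono add_mono) auto
      finally show ?thesis using \<delta>(2) d(2) by simp
    qed
    then show "eventually (\<lambda>n. newton_norm nX (fun_diff (u n) w) < e) sequentially"
      by (auto simp: eventually_sequentially)
  qed simp
  with w show ?thesis by (rule that)
qed

end

section \<open>Transfer from representatives to equivalence classes\<close>

theorem theorem7p1:
  fixes M :: "'a::metric_space measure"
    and nX :: "('a \<Rightarrow> ereal) \<Rightarrow> ennreal"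
    and c :: real
    and U :: "nat \<Rightarrow> ('a \<Rightarrow> ereal) set"
  assumes "quasi_banach_function_lattice M nX c"
    and "\<And>n. U n \<in> newton_quotient M nX"
    and "\<forall>\<epsilon>>0. \<exists>K. \<forall>m\<ge>K. \<forall>n\<ge>K. newton_class_dist nX (U m) (U n) < \<epsilon>"
  shows "\<exists>V\<in>newton_quotient M nX. (\<lambda>n. newton_class_dist nX (U n) V) \<longlonglongrightarrow> 0"
proof -
  interpret quasi_banach_function_lattice M nX c by fact
  have "\<exists>v. v \<in> newton_space M nX \<and> U n = newton_rel M nX `` {v}" for n
    using assms(2)[of n] by (auto simp: newton_quotient_def elim: quotientE)
  then obtain u where u: "\<And>n. u n \<in> newton_space M nX" and U: "\<And>n. U n = newton_rel M nX `` {u n}"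
    by metis
  have "\<exists>K. \<forall>m\<ge>K. \<forall>n\<ge>K. newton_norm nX (fun_diff (u m) (u n)) < \<epsilon>" if "\<epsilon> > 0" for \<epsilon>
    using assms(3) that unfolding U newton_class_dist_eq[OF u u] by blast
  then obtain w where w: "w \<in> newton_space M nX"
    and lim: "(\<lambda>n. newton_norm nX (fun_diff (u n) w)) \<longlonglongrightarrow> 0"
    using cauchy_converges[of u] u by blast
  show ?thesis
  proof
    show "newton_rel M nX `` {w} \<in> newton_quotient M nX"
      unfolding newton_quotient_def using w by (rule quotientI)
    show "(\<lambda>n. newton_class_dist nX (U n) (newton_rel M nX `` {w})) \<longlonglongrightarrow> 0"
      using lim by (simp add: U newton_class_dist_eq[OF u w])
  qed
qed

end
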